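(* Let $1\le p<\infty$. For each $t\in(0,1)$ the operator $C_t$ maps $H^p$ into $H^p$, and $C_t\colon H^p\to H^p$ is continuous with operator norm satisfying $$1\le\|C_t\|_{H^p\to H^p}\le\frac{1}{1-t}.$$ Moreover, for $p=1$, $$\|C_t\|_{H^1\to H^1}\le\frac{-\log(1-t)}{t},$$ and for $1<p<\infty$, $$\|C_t\|_{H^p\to H^p}\le\left[\frac{1}{t(p-1)}\left(\frac{1}{(1-t)^{p-1}}-1\right)\right]^{1/p}.$$
   Context: Let $\mathbb{D}=\{z\in\mathbb{C}:|z|<1\}$ and let $H(\mathbb{D})$ be the space of holomorphic functions on $\mathbb{D}$. For $1\le p<\infty$ the Hardy space $H^p$ is the Banach space of all $f\in H(\mathbb{D})$ with $\|f\|_p:=\sup_{0\le r<1}\left(\frac{1}{2\pi}\int_0^{2\pi}|f(re^{i\theta})|^p\,d\theta\right)^{1/p}<\infty$. For $t\in[0,1)$ the generalized Cesàro operator $C_t\colon H(\mathbb{D})\to H(\mathbb{D})$ is defined by $(C_tf)(0):=f(0)$ and $(C_tf)(z):=\frac1z\int_0^z\frac{f(\xi)}{1-t\xi}\,d\xi$ for $z\in\mathbb{D}\setminus\{0\}$. *)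

theory Defs
  imports "HOL-Complex_Analysis.Complex_Analysis"
begin

text \<open>
  A function on the open unit disc is represented by a total function on \<open>complex\<close>, and only its
  values on \<open>ball 0 1\<close> matter.  The norm takes values in \<open>ennreal\<close>, so that it is meaningful
  (possibly infinite) for every function that is holomorphic on the disc.
\<close>

definition hardy_norm :: "real \<Rightarrow> (complex \<Rightarrow> complex) \<Rightarrow> ennreal" where
  "hardy_norm p f =
     (SUP r\<in>{0..<1::real}.
        ennreal ((1 / (2 * pi) * integral {0..2 * pi} (\<lambda>\<theta>. norm (f (rcis r \<theta>)) powr p)) powr (1 / p)))"

definition hardy_space :: "real \<Rightarrow> (complex \<Rightarrow> complex) set" where
  "hardy_space p = {f. f holomorphic_on ball 0 1 \<and> hardy_norm p f < \<infinity>}"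

text \<open>
  For \<open>f\<close> holomorphic on the disc the integrand below is holomorphic there, so the integral
  from \<open>0\<close> to \<open>z\<close> is independent of the path; the straight segment is used.
\<close>

definition cesaro_op :: "real \<Rightarrow> (complex \<Rightarrow> complex) \<Rightarrow> complex \<Rightarrow> complex" where
  "cesaro_op t f z =
     (if z = 0 then f 0
      else 1 / z * contour_integral (linepath 0 z) (\<lambda>\<xi>. f \<xi> / (1 - of_real t * \<xi>)))"

definition hardy_continuous :: "real \<Rightarrow> ((complex \<Rightarrow> complex) \<Rightarrow> (complex \<Rightarrow> complex)) \<Rightarrow> bool" where
  "hardy_continuous p T \<longleftrightarrow>
     (\<forall>f\<in>hardy_space p. \<forall>\<epsilon>>0. \<exists>\<delta>>0. \<forall>g\<in>hardy_space p.
        hardy_norm p (\<lambda>z. g z - f z) < ennreal \<delta> \<longrightarrow>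
        hardy_norm p (\<lambda>z. T g z - T f z) < ennreal \<epsilon>)"

definition hardy_opnorm :: "real \<Rightarrow> ((complex \<Rightarrow> complex) \<Rightarrow> (complex \<Rightarrow> complex)) \<Rightarrow> ennreal" where
  "hardy_opnorm p T = (SUP f\<in>{f \<in> hardy_space p. hardy_norm p f \<le> 1}. hardy_norm p (T f))"

end

theory Submission
  imports Defs
begin

text \<open>
  Substituting \<open>\<xi> = s * z\<close> in the defining integral exhibits \<open>C\<^sub>t f(z)\<close> as the average over
  \<open>s \<in> [0, 1]\<close> of \<open>f (s * z) / (1 - t * s * z)\<close>, a formula that is also correct at \<open>z = 0\<close>
  (\<open>cesaro_op_has_integral\<close>).  On the disc the denominator is at least \<open>1 - t * s\<close> in
  absolute value, so Jensen's inequality for \<open>x \<mapsto> x powr p\<close> on the unit interval bounds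
  \<open>|C\<^sub>t f(z)| powr p\<close> by the integral of \<open>|f (s * z)| powr p * (1 - t * s) powr (-p)\<close>
  (\<open>norm_cesaro_op_powr_le\<close>).  Averaging over a circle of radius \<open>r\<close> and exchanging the two
  integrals leaves the circle means of \<open>f\<close> at the radii \<open>s * r\<close>, all of which are at most the
  \<open>p\<close>-th power of the Hardy norm (\<open>hardy_mean_cesaro_op_le\<close>).  Hence the operator norm is at most
  the \<open>p\<close>-th root of the integral of \<open>(1 - t * s) powr (-p)\<close> over \<open>[0, 1]\<close>.  Evaluating this
  integral gives the bounds special to \<open>p = 1\<close> and to \<open>p > 1\<close>; estimating its integrand by the
  value at \<open>s = 1\<close> gives \<open>1 / (1 - t)\<close>.

  The lower bound is tested on the constant function \<open>1\<close>: its image takes the value \<open>1\<close> at the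
  origin, which is the mean over the circle of radius \<open>0\<close>.  That \<open>C\<^sub>t f\<close> is holomorphic follows
  from a primitive \<open>H\<close> of the integrand, since \<open>C\<^sub>t f\<close> is the difference quotient of \<open>H\<close> at \<open>0\<close>
  with its removable singularity filled in.  Continuity is the norm bound applied to differences.
\<close>

section \<open>Jensen's inequality for powers on the unit interval\<close>

text \<open>
  Convexity of \<open>x \<mapsto> x powr p\<close> on the open half-line gives the tangent inequality for positive
  \<open>x\<close>.  At \<open>x = 0\<close> it reduces to \<open>1 \<le> p\<close>.
\<close>

lemma powr_above_tangent:
  fixes p x m :: real
  assumes "1 \<le> p" "0 \<le> x" "0 < m"
  shows "m powr p + p * m powr (p - 1) * (x - m) \<le> x powr p"
proof (cases "x = 0")
  case True
  have "m powr p = m powr (p - 1) * m"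
    using assms by (simp add: powr_mult_base mult.commute)
  then show ?thesis
    using assms True by (simp add: algebra_simps mult_left_mono)
next
  case False
  have "p * m powr (p - 1) * (x - m) \<le> x powr p - m powr p"
  proof (rule convex_on_imp_above_tangent[OF powr_convex[OF assms(1)]])
    show "((\<lambda>x. x powr p) has_real_derivative p * m powr (p - 1)) (at m within {0<..})"
      using assms by (auto intro!: derivative_eq_intros)
  qed (use assms False in \<open>auto simp: interior_open\<close>)
  then show ?thesis by simp
qed

text \<open>
  Integrating the tangent to \<open>x \<mapsto> x powr p\<close> at the mean value of \<open>g\<close> kills the linear term,
  because the interval has length one.
\<close>

lemma integral_powr_le:
  fixes g :: "real \<Rightarrow> real"
  assumes "1 \<le> p" and g: "g integrable_on {0..1}"
    and gp: "(\<lambda>s. g s powr p) integrable_on {0..1}"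
    and nonneg: "\<And>s. s \<in> {0..1} \<Longrightarrow> 0 \<le> g s"
  shows "integral {0..1} g powr p \<le> integral {0..1} (\<lambda>s. g s powr p)"
proof -
  define m where "m = integral {0..1} g"
  have "0 \<le> m"
    unfolding m_def using nonneg by (intro integral_nonneg g) auto
  show ?thesis
  proof (cases "m = 0")
    case True
    then show ?thesis
      using gp by (simp flip: m_def add: integral_nonneg)
  next
    case False
    have const: "((\<lambda>s. c) has_integral c) {0..1::real}" for c :: real
      using has_integral_const_real[of c 0 1] by simp
    have "((\<lambda>s. m powr p + p * m powr (p - 1) * (g s - m)) has_integral
            (m powr p + p * m powr (p - 1) * (integral {0..1} g - m))) {0..1}"
      by (intro has_integral_add has_integral_mult_right has_integral_diff const integrable_integral g)
    then have "((\<lambda>s. m powr p + p * m powr (p - 1) * (g s - m)) has_integral m powr p) {0..1}"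
      by (simp flip: m_def)
    then have "m powr p \<le> integral {0..1} (\<lambda>s. g s powr p)"
    proof (rule has_integral_le[OF _ integrable_integral[OF gp]])
      fix s :: real assume "s \<in> {0..1}"
      then show "m powr p + p * m powr (p - 1) * (g s - m) \<le> g s powr p"
        using \<open>0 \<le> m\<close> False nonneg by (intro powr_above_tangent assms(1)) auto
    qed
    then show ?thesis by (simp add: m_def)
  qed
qed

section \<open>The Cesaro operator on holomorphic functions\<close>

lemma cesaro_kernel_pos:
  fixes t s :: real
  assumes "t < 1" "s \<in> {0..1}"
  shows "0 < 1 - t * s"
proof (cases "0 \<le> t")
  case True
  then have "t * s \<le> t * 1" using assms by (intro mult_left_mono) auto
  then show ?thesis using assms by simp
next
  case False
  then have "t * s \<le> 0" using assms by (intro mult_nonpos_nonneg) auto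
  then show ?thesis by simp
qed

lemma one_minus_mult_neq_0:
  assumes "0 \<le> t" "t < 1" "norm z < 1"
  shows "1 - complex_of_real t * z \<noteq> 0"
proof
  assume "1 - complex_of_real t * z = 0"
  then have "norm (complex_of_real t * z) = 1" by simp
  then have "t * norm z = 1" using assms by (simp add: norm_mult)
  moreover have "t * norm z \<le> t * 1" using assms by (intro mult_left_mono) auto
  ultimately show False using assms by simp
qed

lemma holomorphic_on_cesaro_integrand:
  assumes "f holomorphic_on ball 0 1" "0 \<le> t" "t < 1"
  shows "(\<lambda>z. f z / (1 - of_real t * z)) holomorphic_on ball 0 1"
  using assms one_minus_mult_neq_0[OF assms(2,3)] by (intro holomorphic_intros) auto

lemma norm_of_real_mult_less_1:
  fixes z :: complex
  assumes "s \<in> {0..1}" "norm z < 1"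
  shows "norm (of_real s * z) < 1"
proof -
  have "norm (of_real s * z) \<le> 1 * norm z"
    unfolding norm_mult using assms by (intro mult_right_mono) auto
  with assms show ?thesis by simp
qed

text \<open>
  The parametrisation \<open>\<xi> = s * z\<close> contributes a factor \<open>z\<close> that cancels the \<open>1 / z\<close> of the
  definition, so the special value at \<open>z = 0\<close> fits the same formula.
\<close>

lemma cesaro_op_has_integral:
  assumes f: "f holomorphic_on ball 0 1" and t: "0 \<le> t" "t < 1" and z: "norm z < 1"
  shows "((\<lambda>s. f (of_real s * z) / (1 - of_real t * (of_real s * z)))
           has_integral cesaro_op t f z) {0..1}"
proof (cases "z = 0")
  case True
  then show ?thesis
    using has_integral_const_real[of "f 0" 0 1] by (simp add: cesaro_op_def)
next
  case False
  define h where "h = (\<lambda>z. f z / (1 - of_real t * z))"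
  have "closed_segment 0 z \<subseteq> ball 0 1"
    using z by (intro closed_segment_subset) auto
  then have "h contour_integrable_on linepath 0 z"
    unfolding h_def using holomorphic_on_cesaro_integrand[OF f t]
    by (intro contour_integrable_continuous_linepath holomorphic_on_imp_continuous_on)
      (auto intro: holomorphic_on_subset)
  then have "((\<lambda>s. h (linepath 0 z s) * (z - 0)) has_integral contour_integral (linepath 0 z) h) {0..1}"
    unfolding has_contour_integral_linepath[symmetric] by (rule has_contour_integral_integral)
  then have "((\<lambda>s. 1 / z * (h (of_real s * z) * z)) has_integral
               1 / z * contour_integral (linepath 0 z) h) {0..1}"
    by (intro has_integral_mult_right) (simp add: linepath_def scaleR_conv_of_real)
  then show ?thesis
    using False by (simp add: h_def cesaro_op_def)
qed

lemma cesaro_op_diff: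
  assumes "f holomorphic_on ball 0 1" "g holomorphic_on ball 0 1" "0 \<le> t" "t < 1" "norm z < 1"
  shows "cesaro_op t (\<lambda>z. g z - f z) z = cesaro_op t g z - cesaro_op t f z"
proof (rule has_integral_unique)
  show "((\<lambda>s. g (of_real s * z) / (1 - of_real t * (of_real s * z))
            - f (of_real s * z) / (1 - of_real t * (of_real s * z)))
          has_integral cesaro_op t g z - cesaro_op t f z) {0..1}"
    using assms by (intro has_integral_diff cesaro_op_has_integral)
  show "((\<lambda>s. g (of_real s * z) / (1 - of_real t * (of_real s * z))
            - f (of_real s * z) / (1 - of_real t * (of_real s * z)))
          has_integral cesaro_op t (\<lambda>z. g z - f z) z) {0..1}"
    unfolding diff_divide_distrib[symmetric]
    using assms by (intro cesaro_op_has_integral holomorphic_intros)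
qed

text \<open>
  With \<open>H\<close> a primitive of \<open>f z / (1 - t * z)\<close>, the function \<open>C\<^sub>t f\<close> is \<open>(H z - H 0) / z\<close> away
  from the origin and \<open>f 0 = deriv H 0\<close> at it, so the singularity is removable.
\<close>

lemma holomorphic_on_cesaro_op:
  assumes f: "f holomorphic_on ball 0 1" and t: "0 \<le> t" "t < 1"
  shows "cesaro_op t f holomorphic_on ball 0 1"
proof -
  define h where "h = (\<lambda>z. f z / (1 - of_real t * z))"
  obtain H where H: "\<And>z. z \<in> ball 0 1 \<Longrightarrow> (H has_field_derivative h z) (at z within ball 0 1)"
    unfolding h_def
    using holomorphic_convex_primitive'[OF _ _ holomorphic_on_cesaro_integrand[OF f t]] by auto
  have "H holomorphic_on ball 0 1"
    using H unfolding holomorphic_on_def field_differentiable_def by blast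
  then have "(\<lambda>z. if z = 0 then deriv H 0 else (H z - H 0) / (z - 0)) holomorphic_on ball 0 1"
    by (rule pole_lemma) simp
  then show ?thesis
  proof (rule holomorphic_transform)
    fix z :: complex assume z: "z \<in> ball 0 1"
    have "deriv H 0 = f 0"
      using H[of 0] at_within_open[of "0::complex" "ball 0 1"] by (auto simp: h_def intro!: DERIV_imp_deriv)
    moreover have "closed_segment 0 z \<subseteq> ball 0 1"
      using z by (intro closed_segment_subset) auto
    then have "(h has_contour_integral H z - H 0) (linepath 0 z)"
      using contour_integral_primitive[OF H, of "linepath 0 z"] by auto
    then have "contour_integral (linepath 0 z) h = H z - H 0"
      by (rule contour_integral_unique)
    ultimately show "(if z = 0 then deriv H 0 else (H z - H 0) / (z - 0)) = cesaro_op t f z"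
      by (simp add: cesaro_op_def h_def)
  qed
qed

section \<open>The bound for circle means\<close>

text \<open>
  The triangle inequality moves the norm inside the averaging formula, where
  \<open>norm (1 - t * s * z) \<ge> 1 - t * s\<close>; Jensen's inequality then moves the power inside.
\<close>

lemma norm_cesaro_op_powr_le:
  assumes f: "f holomorphic_on ball 0 1" and t: "0 \<le> t" "t < 1" and z: "norm z < 1" and p: "1 \<le> p"
  shows "norm (cesaro_op t f z) powr p
           \<le> integral {0..1} (\<lambda>s. norm (f (of_real s * z)) powr p * (1 - t * s) powr (- p))"
proof -
  define G where "G = (\<lambda>s. norm (f (of_real s * z)) / (1 - t * s))"
  have f_cont: "continuous_on {0..1} (\<lambda>s::real. f (of_real s * z))"
    using norm_of_real_mult_less_1[OF _ z]
    by (intro continuous_on_compose2[OF holomorphic_on_imp_continuous_on[OF f]] continuous_intros) auto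
  have pos: "0 < 1 - t * s" if "s \<in> {0..1}" for s
    using cesaro_kernel_pos[OF t(2) that] .
  have G_cont: "continuous_on {0..1} G"
    unfolding G_def using pos by (intro continuous_intros f_cont) force
  have G_nonneg: "0 \<le> G s" if "s \<in> {0..1}" for s
    using pos[OF that] by (simp add: G_def)
  have "norm (cesaro_op t f z) \<le> integral {0..1} G"
  proof -
    note I = cesaro_op_has_integral[OF f t z]
    have "norm (f (of_real s * z) / (1 - of_real t * (of_real s * z))) \<le> G s" if s: "s \<in> {0..1}" for s :: real
    proof -
      have "t * s * norm z \<le> t * s * 1"
        using t s z by (intro mult_left_mono) auto
      then have "1 - t * s \<le> 1 - norm (of_real t * (of_real s * z))"
        using t s by (simp add: norm_mult)
      also have "\<dots> \<le> norm (1 - of_real t * (of_real s * z))"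
        using norm_triangle_ineq2[of 1 "of_real t * (of_real s * z)"] by simp
      finally show ?thesis
        unfolding G_def norm_divide using pos[OF s]
        by (intro divide_left_mono mult_pos_pos) (auto simp del: zero_less_norm_iff)
    qed
    then show ?thesis
      using integral_norm_bound_integral[OF has_integral_integrable[OF I]
          integrable_continuous_real[OF G_cont]] integral_unique[OF I] by simp
  qed
  then have "norm (cesaro_op t f z) powr p \<le> integral {0..1} G powr p"
    using p by (intro powr_mono2) auto
  also have "\<dots> \<le> integral {0..1} (\<lambda>s. G s powr p)"
    using G_nonneg p G_cont
    by (intro integral_powr_le integrable_continuous_real continuous_on_powr') auto
  also have "\<dots> = integral {0..1} (\<lambda>s. norm (f (of_real s * z)) powr p * (1 - t * s) powr (- p))"
  proof (rule integral_cong)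
    fix s :: real assume "s \<in> {0..1}"
    then show "G s powr p = norm (f (of_real s * z)) powr p * (1 - t * s) powr (- p)"
      using pos[of s] unfolding G_def by (simp add: powr_divide powr_minus field_simps)
  qed
  finally show ?thesis .
qed

definition hardy_mean :: "real \<Rightarrow> (complex \<Rightarrow> complex) \<Rightarrow> real \<Rightarrow> real" where
  "hardy_mean p f r = 1 / (2 * pi) * integral {0..2 * pi} (\<lambda>\<theta>. norm (f (rcis r \<theta>)) powr p)"

text \<open>
  This is the factor by which the operator can enlarge \<open>p\<close>-th power means, so its \<open>p\<close>-th root bounds
  the operator norm.
\<close>

definition cesaro_const :: "real \<Rightarrow> real \<Rightarrow> real" where
  "cesaro_const p t = integral {0..1} (\<lambda>s. (1 - t * s) powr (- p))"

text \<open>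
  After exchanging the integrals, the inner one is the mean of \<open>f\<close> over the circle of radius
  \<open>s * r\<close>, to which the bound \<open>A\<close> applies.
\<close>

lemma hardy_mean_cesaro_op_le:
  assumes f: "f holomorphic_on ball 0 1" and t: "0 \<le> t" "t < 1" and p: "1 \<le> p"
    and A: "\<And>r. r \<in> {0..<1} \<Longrightarrow> hardy_mean p f r \<le> A" and r: "r \<in> {0..<1}"
  shows "hardy_mean p (cesaro_op t f) r \<le> A * cesaro_const p t"
proof -
  define F where "F = (\<lambda>\<theta> s. norm (f (rcis (s * r) \<theta>)) powr p * (1 - t * s) powr (- p))"
  have pos: "0 < 1 - t * s" if "s \<in> {0..1}" for s
    using cesaro_kernel_pos[OF t(2) that] .
  have rs: "s * r \<in> {0..<1}" if "s \<in> {0..1}" for s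
  proof -
    have "s * r \<le> 1 * r" using that r by (intro mult_right_mono) auto
    then show ?thesis using that r by auto
  qed
  have F_cont: "continuous_on (cbox (0, 0) (2 * pi, 1)) (\<lambda>(\<theta>, s). F \<theta> s)"
  proof -
    have f': "continuous_on (cbox (0, 0) (2 * pi, 1::real)) (\<lambda>x. f (rcis (snd x * r) (fst x)))"
      using rs r
      by (intro continuous_on_compose2[OF holomorphic_on_imp_continuous_on[OF f]])
        (auto simp: rcis_def cis_conv_exp norm_mult cbox_Pair_eq intro!: continuous_intros)
    show ?thesis
      unfolding F_def case_prod_beta using p pos
      by (intro continuous_intros continuous_on_powr' f') (force simp: cbox_Pair_eq)+
  qed
  have C_cont: "continuous_on {0..2 * pi} (\<lambda>\<theta>. norm (cesaro_op t f (rcis r \<theta>)) powr p)"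
    using r p
    by (intro continuous_on_powr' continuous_on_norm continuous_on_const
        continuous_on_compose2[OF holomorphic_on_imp_continuous_on[OF holomorphic_on_cesaro_op[OF f t]]])
      (auto simp: rcis_def cis_conv_exp norm_mult intro!: continuous_intros)
  have "hardy_mean p (cesaro_op t f) r
          \<le> 1 / (2 * pi) * integral {0..2 * pi} (\<lambda>\<theta>. integral {0..1} (F \<theta>))"
    unfolding hardy_mean_def
  proof (intro mult_left_mono integral_le integrable_continuous_real C_cont)
    show "continuous_on {0..2 * pi} (\<lambda>\<theta>. integral {0..1} (F \<theta>))"
      using integral_continuous_on_param[of "{0..2 * pi}" 0 1 F] F_cont by (simp add: cbox_Pair_eq)
    fix \<theta> assume "\<theta> \<in> {0..2 * pi}"
    have eq: "complex_of_real s * rcis r \<theta> = rcis (s * r) \<theta>" for s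
      by (simp add: rcis_def)
    show "norm (cesaro_op t f (rcis r \<theta>)) powr p \<le> integral {0..1} (F \<theta>)"
      using norm_cesaro_op_powr_le[OF f t _ p, of "rcis r \<theta>"] r unfolding F_def eq by simp
  qed auto
  also have "integral {0..2 * pi} (\<lambda>\<theta>. integral {0..1} (F \<theta>))
               = integral {0..1} (\<lambda>s. integral {0..2 * pi} (\<lambda>\<theta>. F \<theta> s))"
    using integral_swap_continuous[OF F_cont] by simp
  also have "1 / (2 * pi) * \<dots> = integral {0..1} (\<lambda>s. 1 / (2 * pi) * integral {0..2 * pi} (\<lambda>\<theta>. F \<theta> s))"
    by simp
  also have "\<dots> \<le> integral {0..1} (\<lambda>s. A * (1 - t * s) powr (- p))"
  proof (intro integral_le integrable_continuous_real)
    have "continuous_on (cbox (0, 0) (1, 2 * pi)) (\<lambda>x. case prod.swap x of (\<theta>, s) \<Rightarrow> F \<theta> s)"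
      by (rule continuous_on_compose2[OF F_cont continuous_on_swap]) (auto simp: cbox_Pair_eq)
    then have "continuous_on (cbox (0, 0) (1, 2 * pi)) (\<lambda>(s, \<theta>). F \<theta> s)"
      by (simp add: case_prod_beta)
    then show "continuous_on {0..1} (\<lambda>s. 1 / (2 * pi) * integral {0..2 * pi} (\<lambda>\<theta>. F \<theta> s))"
      using integral_continuous_on_param[of "{0..1}" 0 "2 * pi" "\<lambda>s \<theta>. F \<theta> s"]
      by (auto simp: cbox_Pair_eq intro!: continuous_intros)
    show "continuous_on {0..1} (\<lambda>s. A * (1 - t * s) powr - p)"
      using pos by (intro continuous_intros) force
    fix s :: real assume s: "s \<in> {0..1}"
    have "1 / (2 * pi) * integral {0..2 * pi} (\<lambda>\<theta>. F \<theta> s)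
            = hardy_mean p f (s * r) * (1 - t * s) powr (- p)"
      by (simp add: F_def hardy_mean_def)
    also have "\<dots> \<le> A * (1 - t * s) powr (- p)"
      by (intro mult_right_mono A rs s) simp
    finally show "1 / (2 * pi) * integral {0..2 * pi} (\<lambda>\<theta>. F \<theta> s) \<le> A * (1 - t * s) powr (- p)" .
  qed
  finally show ?thesis by (simp add: cesaro_const_def)
qed

section \<open>From circle means to the Hardy norm\<close>

lemma hardy_mean_nonneg: "0 \<le> hardy_mean p f r"
  unfolding hardy_mean_def
  \<comment> \<open>For a function that is not integrable the integral is \<open>0\<close> by convention.\<close>
  by (cases "(\<lambda>\<theta>. norm (f (rcis r \<theta>)) powr p) integrable_on {0..2 * pi}")
    (auto simp: integral_nonneg not_integrable_integral)

lemma cesaro_const_nonneg: "0 \<le> cesaro_const p t"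
  unfolding cesaro_const_def
  by (cases "(\<lambda>s. (1 - t * s) powr (- p)) integrable_on {0..1}")
    (auto simp: integral_nonneg not_integrable_integral)

text \<open>
  This removes the supremum in \<open>ennreal\<close> and the root from the norm, so that estimates can be
  made on real circle means.
\<close>

lemma hardy_norm_le_iff:
  assumes "0 < p" "0 \<le> B"
  shows "hardy_norm p f \<le> ennreal B \<longleftrightarrow> (\<forall>r\<in>{0..<1}. hardy_mean p f r \<le> B powr p)"
proof -
  have "hardy_mean p f r powr (1 / p) \<le> B \<longleftrightarrow> hardy_mean p f r \<le> B powr p" for r
  proof
    assume "hardy_mean p f r powr (1 / p) \<le> B"
    then have "(hardy_mean p f r powr (1 / p)) powr p \<le> B powr p"
      using assms by (intro powr_mono2) auto
    then show "hardy_mean p f r \<le> B powr p"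
      using assms hardy_mean_nonneg[of p f r] by (simp add: powr_powr)
  next
    assume "hardy_mean p f r \<le> B powr p"
    then have "hardy_mean p f r powr (1 / p) \<le> (B powr p) powr (1 / p)"
      using assms hardy_mean_nonneg[of p f r] by (intro powr_mono2) auto
    then show "hardy_mean p f r powr (1 / p) \<le> B"
      using assms by (simp add: powr_powr)
  qed
  then show ?thesis
    using assms by (simp add: hardy_norm_def hardy_mean_def SUP_le_iff ennreal_le_iff)
qed

lemma hardy_norm_cong:
  assumes "\<And>z. norm z < 1 \<Longrightarrow> f z = g z"
  shows "hardy_norm p f = hardy_norm p g"
  unfolding hardy_norm_def using assms by (intro SUP_cong refl) (simp cong: integral_cong)

lemma hardy_norm_cesaro_op_le:
  assumes f: "f holomorphic_on ball 0 1" and t: "0 \<le> t" "t < 1" and p: "1 \<le> p"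
    and B: "0 \<le> B" "hardy_norm p f \<le> ennreal B"
  shows "hardy_norm p (cesaro_op t f) \<le> ennreal (B * cesaro_const p t powr (1 / p))"
proof -
  have "hardy_mean p (cesaro_op t f) r \<le> B powr p * cesaro_const p t" if "r \<in> {0..<1}" for r
    using that B p hardy_norm_le_iff[of p B f]
    by (intro hardy_mean_cesaro_op_le[OF f t p]) auto
  moreover have "(B * cesaro_const p t powr (1 / p)) powr p = B powr p * cesaro_const p t"
    using p B cesaro_const_nonneg[of p t] by (simp add: powr_mult powr_powr)
  ultimately show ?thesis
    using p B by (subst hardy_norm_le_iff) (auto simp: cesaro_const_nonneg)
qed

section \<open>The constant in the bound\<close>

lemma cesaro_const_1:
  assumes "0 < t" "t < 1"
  shows "cesaro_const 1 t = - ln (1 - t) / t"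
proof -
  have "((\<lambda>s. (1 - t * s) powr (- 1)) has_integral - ln (1 - t * 1) / t - - ln (1 - t * 0) / t) {0..1}"
  proof (rule fundamental_theorem_of_calculus)
    fix s :: real assume s: "s \<in> {0..1}"
    show "((\<lambda>s. - ln (1 - t * s) / t) has_vector_derivative (1 - t * s) powr (- 1)) (at s within {0..1})"
      unfolding has_real_derivative_iff_has_vector_derivative[symmetric]
      using assms cesaro_kernel_pos[OF assms(2) s]
      by (auto intro!: derivative_eq_intros simp: powr_minus field_simps)
  qed simp
  then show ?thesis unfolding cesaro_const_def by (auto dest!: integral_unique)
qed

lemma cesaro_const_gt_1:
  assumes "0 < t" "t < 1" "1 < p"
  shows "cesaro_const p t = 1 / (t * (p - 1)) * (1 / (1 - t) powr (p - 1) - 1)"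
proof -
  let ?F = "\<lambda>s. (1 - t * s) powr (1 - p) / (t * (p - 1))"
  have "((\<lambda>s. (1 - t * s) powr (- p)) has_integral ?F 1 - ?F 0) {0..1}"
  proof (rule fundamental_theorem_of_calculus)
    fix s :: real assume s: "s \<in> {0..1}"
    have "(1 - p) * (1 - t * s) powr (- p) * (- t) / (t * (p - 1)) = (1 - t * s) powr (- p)"
      using assms by (simp add: field_simps)
    then show "(?F has_vector_derivative (1 - t * s) powr (- p)) (at s within {0..1})"
      unfolding has_real_derivative_iff_has_vector_derivative[symmetric]
      using assms cesaro_kernel_pos[OF assms(2) s]
      by (auto intro!: derivative_eq_intros)
  qed simp
  then have "cesaro_const p t = ?F 1 - ?F 0"
    unfolding cesaro_const_def by (rule integral_unique)
  moreover have "(1 - t) powr (1 - p) = 1 / (1 - t) powr (p - 1)"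
    using powr_minus_divide[of "1 - t" "p - 1"] by simp
  ultimately show ?thesis by (simp add: diff_divide_distrib)
qed

lemma cesaro_const_le:
  assumes "0 \<le> t" "t < 1" "0 \<le> p"
  shows "cesaro_const p t \<le> (1 / (1 - t)) powr p"
proof -
  have "cesaro_const p t \<le> integral {0..1} (\<lambda>s::real. (1 / (1 - t)) powr p)"
    unfolding cesaro_const_def
  proof (intro integral_le integrable_continuous_real)
    show "continuous_on {0..1} (\<lambda>s. (1 - t * s) powr (- p))"
      using cesaro_kernel_pos[OF assms(2)] by (intro continuous_intros) force
    fix s :: real assume s: "s \<in> {0..1}"
    have "t * s \<le> t * 1" using assms s by (intro mult_left_mono) auto
    then have "1 / (1 - t * s) \<le> 1 / (1 - t)"
      using assms by (intro divide_left_mono) auto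
    then have "(1 / (1 - t * s)) powr p \<le> (1 / (1 - t)) powr p"
      using assms cesaro_kernel_pos[OF assms(2) s] by (intro powr_mono2) auto
    then show "(1 - t * s) powr (- p) \<le> (1 / (1 - t)) powr p"
      using assms cesaro_kernel_pos[OF assms(2) s] by (simp add: powr_divide powr_minus field_simps)
  qed auto
  then show ?thesis by simp
qed

section \<open>Operator norm, continuity and invariance\<close>

lemma hardy_opnorm_cesaro_op_le:
  assumes "0 \<le> t" "t < 1" "1 \<le> p"
  shows "hardy_opnorm p (cesaro_op t) \<le> ennreal (cesaro_const p t powr (1 / p))"
  unfolding hardy_opnorm_def
proof (rule SUP_least)
  fix f assume "f \<in> {f \<in> hardy_space p. hardy_norm p f \<le> 1}"
  then show "hardy_norm p (cesaro_op t f) \<le> ennreal (cesaro_const p t powr (1 / p))"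
    using hardy_norm_cesaro_op_le[OF _ assms, of f 1] by (simp add: hardy_space_def)
qed

text \<open>
  The constant function \<open>1\<close> has norm one and \<open>C\<^sub>t 1(0) = 1\<close>; the radius \<open>0\<close>, which takes part in
  the supremum, sees only this value.
\<close>

lemma one_le_hardy_opnorm_cesaro_op:
  assumes "0 < p"
  shows "1 \<le> hardy_opnorm p (cesaro_op t)"
proof -
  have "hardy_norm p (\<lambda>_. 1) \<le> ennreal 1"
    using assms by (subst hardy_norm_le_iff) (auto simp: hardy_mean_def)
  moreover from this have "(\<lambda>_. 1) \<in> hardy_space p"
    by (auto simp: hardy_space_def less_top[symmetric] top_unique)
  ultimately have "hardy_norm p (cesaro_op t (\<lambda>_. 1)) \<le> hardy_opnorm p (cesaro_op t)"
    unfolding hardy_opnorm_def by (intro SUP_upper) auto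
  moreover have "1 \<le> hardy_norm p (cesaro_op t (\<lambda>_. 1))"
    unfolding hardy_norm_def by (rule SUP_upper2[of 0]) (auto simp: cesaro_op_def)
  ultimately show ?thesis by (rule order_trans[rotated])
qed

text \<open>
  By linearity a Lipschitz bound suffices.
\<close>

lemma hardy_continuous_cesaro_op:
  assumes t: "0 \<le> t" "t < 1" and p: "1 \<le> p"
  shows "hardy_continuous p (cesaro_op t)"
  unfolding hardy_continuous_def
proof (intro ballI allI impI)
  fix f and \<epsilon> :: real assume f: "f \<in> hardy_space p" and \<epsilon>: "\<epsilon> > 0"
  define K where "K = cesaro_const p t powr (1 / p)"
  \<comment> \<open>The denominator is \<open>K + 1\<close> so that \<open>\<delta> * K\<close> is strictly below \<open>\<epsilon>\<close>, also when \<open>K = 0\<close>.\<close>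
  define \<delta> where "\<delta> = \<epsilon> / (K + 1)"
  have "0 \<le> K" by (simp add: K_def)
  then have \<delta>: "0 < \<delta>" "\<delta> * K < \<epsilon>" using \<epsilon> by (auto simp: \<delta>_def field_simps)
  show "\<exists>\<delta>>0. \<forall>g\<in>hardy_space p. hardy_norm p (\<lambda>z. g z - f z) < ennreal \<delta> \<longrightarrow>
          hardy_norm p (\<lambda>z. cesaro_op t g z - cesaro_op t f z) < ennreal \<epsilon>"
  proof (intro exI[of _ \<delta>] conjI ballI impI \<delta>(1))
    fix g assume g: "g \<in> hardy_space p" and close: "hardy_norm p (\<lambda>z. g z - f z) < ennreal \<delta>"
    have hol: "f holomorphic_on ball 0 1" "g holomorphic_on ball 0 1"
      using f g by (auto simp: hardy_space_def)
    have "hardy_norm p (\<lambda>z. cesaro_op t g z - cesaro_op t f z)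
            = hardy_norm p (cesaro_op t (\<lambda>z. g z - f z))"
      by (intro hardy_norm_cong cesaro_op_diff[symmetric] hol t)
    also have "\<dots> \<le> ennreal (\<delta> * K)"
      unfolding K_def using close \<delta>(1) by (intro hardy_norm_cesaro_op_le holomorphic_intros hol t p) auto
    also have "\<dots> < ennreal \<epsilon>"
      using \<delta> \<open>0 \<le> K\<close> by (intro ennreal_lessI) (use \<epsilon> in auto)
    finally show "hardy_norm p (\<lambda>z. cesaro_op t g z - cesaro_op t f z) < ennreal \<epsilon>" .
  qed
qed

lemma cesaro_op_in_hardy_space:
  assumes t: "0 \<le> t" "t < 1" and p: "1 \<le> p" and f: "f \<in> hardy_space p"
  shows "cesaro_op t f \<in> hardy_space p"
proof -
  have hol: "f holomorphic_on ball 0 1" and "hardy_norm p f < \<infinity>"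
    using f by (auto simp: hardy_space_def)
  then have "hardy_norm p f \<le> ennreal (enn2real (hardy_norm p f))"
    by (simp add: less_top)
  from hardy_norm_cesaro_op_le[OF hol t p _ this] have "hardy_norm p (cesaro_op t f) < \<infinity>"
    by (auto simp: enn2real_nonneg intro: le_less_trans)
  with holomorphic_on_cesaro_op[OF hol t] show ?thesis
    by (simp add: hardy_space_def)
qed

theorem proposition3p3:
  fixes p t :: real
  assumes "1 \<le> p" and "0 < t" and "t < 1"
  shows "cesaro_op t ` hardy_space p \<subseteq> hardy_space p
    \<and> hardy_continuous p (cesaro_op t)
    \<and> 1 \<le> hardy_opnorm p (cesaro_op t)
    \<and> hardy_opnorm p (cesaro_op t) \<le> ennreal (1 / (1 - t))
    \<and> (p = 1 \<longrightarrow> hardy_opnorm p (cesaro_op t) \<le> ennreal (- ln (1 - t) / t))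
    \<and> (1 < p \<longrightarrow> hardy_opnorm p (cesaro_op t)
          \<le> ennreal ((1 / (t * (p - 1)) * (1 / (1 - t) powr (p - 1) - 1)) powr (1 / p)))"
proof (intro conjI impI)
  have t: "0 \<le> t" "t < 1" using assms by auto
  note bound = hardy_opnorm_cesaro_op_le[OF t assms(1)]
  show "cesaro_op t ` hardy_space p \<subseteq> hardy_space p"
    using cesaro_op_in_hardy_space[OF t assms(1)] by blast
  show "hardy_continuous p (cesaro_op t)"
    by (rule hardy_continuous_cesaro_op[OF t assms(1)])
  show "1 \<le> hardy_opnorm p (cesaro_op t)"
    using assms by (intro one_le_hardy_opnorm_cesaro_op) auto
  have "cesaro_const p t powr (1 / p) \<le> ((1 / (1 - t)) powr p) powr (1 / p)"
    using assms by (intro powr_mono2 cesaro_const_le) (auto simp: cesaro_const_nonneg)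
  also have "\<dots> = 1 / (1 - t)"
    using assms by (simp add: powr_powr)
  finally show "hardy_opnorm p (cesaro_op t) \<le> ennreal (1 / (1 - t))"
    using bound ennreal_leI order_trans by blast
  show "hardy_opnorm p (cesaro_op t) \<le> ennreal (- ln (1 - t) / t)" if "p = 1"
  proof -
    have "cesaro_const p t powr (1 / p) = cesaro_const 1 t"
      using that cesaro_const_nonneg[of 1 t] by simp
    also have "\<dots> = - ln (1 - t) / t"
      by (rule cesaro_const_1[OF assms(2,3)])
    finally show ?thesis using bound by (rule subst)
  qed
  show "hardy_opnorm p (cesaro_op t)
          \<le> ennreal ((1 / (t * (p - 1)) * (1 / (1 - t) powr (p - 1) - 1)) powr (1 / p))" if "1 < p"
    using bound unfolding cesaro_const_gt_1[OF assms(2,3) that] .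
qed

end
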